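(* Let $G$ be a subgroup of $S_n$ and let $Z_G=\frac{1}{|G|}\sum_{g\in G}p_{\lambda(g)}\in\mathsf{Sym}$ be its cycle index polynomial. Then $Z_G$ has saturated Newton polytope.
   Context: $\lambda(g)$ is the cycle type of $g$, $p_k=\sum_i x_i^k$ and $p_\lambda=p_{\lambda_1}p_{\lambda_2}\cdots$, in the ring $\mathsf{Sym}$ of symmetric functions in $x_1,x_2,\ldots$. A polynomial $h=\sum c_\alpha x^\alpha$ has saturated Newton polytope (SNP) if every lattice point of $\mathrm{conv}\{\alpha:c_\alpha\neq0\}$ is an exponent vector with nonzero coefficient; $f\in\mathsf{Sym}$ is SNP if $f(x_1,\ldots,x_m)$ (setting $x_i=0$ for $i>m$) is SNP for every $m\geq1$. *)

theory Defs
  imports "HOL-Analysis.Convex" "HOL-Analysis.Finite_Function_Topology" "HOL-Algebra.Sym_Groups"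
    "HOL-Combinatorics.Orbits"
begin

text \<open>An exponent vector is a finitely supported function \<^typ>\<open>nat \<Rightarrow>\<^sub>0 nat\<close>. Variables are
  indexed from 0, so the mathematical variable $x_i$ ($i \ge 1$) has index $i - 1$.\<close>

type_synonym exponent = "nat \<Rightarrow>\<^sub>0 nat"

definition total_degree :: "exponent \<Rightarrow> nat" where
  "total_degree \<alpha> = (\<Sum>i\<in>Poly_Mapping.keys \<alpha>. Poly_Mapping.lookup \<alpha> i)"

lemma total_degree_superset:
  assumes "finite A" "Poly_Mapping.keys \<alpha> \<subseteq> A"
  shows "total_degree \<alpha> = (\<Sum>i\<in>A. Poly_Mapping.lookup \<alpha> i)"
  unfolding total_degree_def
  by (rule sum.mono_neutral_left) (use assms in \<open>auto simp: in_keys_iff\<close>)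

lemma keys_add_exponent:
  "Poly_Mapping.keys (\<beta> + \<gamma>) = Poly_Mapping.keys \<beta> \<union> Poly_Mapping.keys (\<gamma> :: exponent)"
  by (auto simp: in_keys_iff lookup_add)

lemma total_degree_add: "total_degree (\<beta> + \<gamma>) = total_degree \<beta> + total_degree \<gamma>"
proof -
  let ?A = "Poly_Mapping.keys \<beta> \<union> Poly_Mapping.keys \<gamma>"
  have "total_degree \<delta> = (\<Sum>i\<in>?A. Poly_Mapping.lookup \<delta> i)" if "\<delta> \<in> {\<beta>, \<gamma>, \<beta> + \<gamma>}" for \<delta>
    using that by (intro total_degree_superset) (auto simp: keys_add_exponent)
  then show ?thesis by (simp add: lookup_add sum.distrib)
qed

lemma lookup_le_total_degree: "Poly_Mapping.lookup \<alpha> i \<le> total_degree \<alpha>"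
proof (cases "i \<in> Poly_Mapping.keys \<alpha>")
  case True
  then show ?thesis unfolding total_degree_def by (intro member_le_sum) auto
qed (simp add: in_keys_iff)

lemma finite_bounded_exponents:
  assumes "finite A"
  shows "finite {\<alpha> :: exponent. Poly_Mapping.keys \<alpha> \<subseteq> A \<and> total_degree \<alpha> \<le> d}" (is "finite ?E")
proof -
  have "finite {f :: nat \<Rightarrow> nat. \<forall>x. (x \<in> A \<longrightarrow> f x \<in> {..d}) \<and> (x \<notin> A \<longrightarrow> f x = 0)}" (is "finite ?F")
    by (rule finite_set_of_finite_funs) (use assms in auto)
  moreover have "Poly_Mapping.lookup ` ?E \<subseteq> ?F"
  proof (rule image_subsetI)
    fix \<alpha> assume \<alpha>: "\<alpha> \<in> ?E"
    have "Poly_Mapping.lookup \<alpha> x \<le> d" for x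
      using \<alpha> lookup_le_total_degree[of \<alpha> x] by simp
    moreover have "Poly_Mapping.lookup \<alpha> x = 0" if "x \<notin> A" for x
      using \<alpha> that by (auto simp: in_keys_iff)
    ultimately show "Poly_Mapping.lookup \<alpha> \<in> ?F" by simp
  qed
  ultimately have "finite (Poly_Mapping.lookup ` ?E)" by (rule rev_finite_subset)
  then show ?thesis by (rule finite_imageD) (auto intro: inj_onI)
qed

lemma finite_exponent_splits: "finite {(\<beta>, \<gamma>). \<beta> + \<gamma> = (\<alpha> :: exponent)}"
proof -
  let ?E = "{\<beta> :: exponent. Poly_Mapping.keys \<beta> \<subseteq> Poly_Mapping.keys \<alpha> \<and> total_degree \<beta> \<le> total_degree \<alpha>}"
  have "{(\<beta>, \<gamma>). \<beta> + \<gamma> = \<alpha>} \<subseteq> ?E \<times> ?E"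
    by (auto simp: keys_add_exponent total_degree_add)
  then show ?thesis
    by (rule finite_subset) (intro finite_cartesian_product finite_bounded_exponents finite_keys)
qed

lemma map_key_inv:
  assumes "bij \<pi>"
  shows "Poly_Mapping.map_key \<pi> (Poly_Mapping.map_key (Hilbert_Choice.inv \<pi>) \<alpha>) = \<alpha>"
    and "Poly_Mapping.map_key (Hilbert_Choice.inv \<pi>) (Poly_Mapping.map_key \<pi> \<alpha>) = \<alpha>"
proof -
  note inj = bij_is_inj[OF assms] bij_is_inj[OF bij_imp_bij_inv[OF assms]]
  show "Poly_Mapping.map_key \<pi> (Poly_Mapping.map_key (Hilbert_Choice.inv \<pi>) \<alpha>) = \<alpha>"
    by (rule poly_mapping_eqI) (simp add: map_key.rep_eq inj)
  show "Poly_Mapping.map_key (Hilbert_Choice.inv \<pi>) (Poly_Mapping.map_key \<pi> \<alpha>) = \<alpha>"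
    by (rule poly_mapping_eqI)
      (simp add: map_key.rep_eq inj surj_f_inv_f[OF bij_is_surj[OF assms]])
qed


text \<open>The ring $\mathsf{Sym}$: formal power series in infinitely many variables, given by their
  coefficients, that have bounded degree and are invariant under permuting the variables.\<close>

typedef (overloaded) 'a symfun =
  "{f :: exponent \<Rightarrow> 'a :: zero.
     (\<exists>d. \<forall>\<alpha>. f \<alpha> \<noteq> 0 \<longrightarrow> total_degree \<alpha> \<le> d) \<and>
     (\<forall>\<pi> \<alpha>. bij \<pi> \<longrightarrow> f (Poly_Mapping.map_key \<pi> \<alpha>) = f \<alpha>)}"
  morphisms sf_coeff Abs_symfun
  by (rule exI[of _ "\<lambda>_. 0"]) auto

setup_lifting type_definition_symfun

instantiation symfun :: (comm_ring_1) comm_ring_1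
begin

lift_definition zero_symfun :: "'a symfun" is "\<lambda>_. 0" by auto

lift_definition one_symfun :: "'a symfun" is "\<lambda>\<alpha>. if \<alpha> = 0 then 1 else 0"
proof (intro conjI, goal_cases)
  case 1
  show ?case by (rule exI[of _ 0]) (auto simp: total_degree_def)
next
  case 2
  show ?case
  proof (intro allI impI)
    fix \<pi> :: "nat \<Rightarrow> nat" and \<alpha> :: exponent
    assume \<pi>: "bij \<pi>"
    note inj = bij_is_inj[OF \<pi>] bij_is_inj[OF bij_imp_bij_inv[OF \<pi>]]
    have "Poly_Mapping.map_key \<pi> \<alpha> = 0 \<longleftrightarrow> \<alpha> = 0"
      using map_key_inv(2)[OF \<pi>, of \<alpha>] map_key_zero[OF inj(1)] map_key_zero[OF inj(2)] by metis
    then show "(if Poly_Mapping.map_key \<pi> \<alpha> = 0 then 1 else 0) = (if \<alpha> = 0 then 1 else 0)"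
      by simp
  qed
qed

lift_definition plus_symfun :: "'a symfun \<Rightarrow> 'a symfun \<Rightarrow> 'a symfun" is "\<lambda>f g \<alpha>. f \<alpha> + g \<alpha>"
proof (elim conjE exE, intro conjI)
  fix f g :: "exponent \<Rightarrow> 'a" and d e
  assume "\<forall>\<alpha>. f \<alpha> \<noteq> 0 \<longrightarrow> total_degree \<alpha> \<le> d" "\<forall>\<alpha>. g \<alpha> \<noteq> 0 \<longrightarrow> total_degree \<alpha> \<le> e"
  then show "\<exists>d. \<forall>\<alpha>. f \<alpha> + g \<alpha> \<noteq> 0 \<longrightarrow> total_degree \<alpha> \<le> d"
    by (intro exI[of _ "max d e"]) (metis add_0 max.coboundedI1 max.coboundedI2)
qed auto

lift_definition uminus_symfun :: "'a symfun \<Rightarrow> 'a symfun" is "\<lambda>f \<alpha>. - f \<alpha>" by auto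

lift_definition minus_symfun :: "'a symfun \<Rightarrow> 'a symfun \<Rightarrow> 'a symfun" is "\<lambda>f g \<alpha>. f \<alpha> - g \<alpha>"
proof (elim conjE exE, intro conjI)
  fix f g :: "exponent \<Rightarrow> 'a" and d e
  assume "\<forall>\<alpha>. f \<alpha> \<noteq> 0 \<longrightarrow> total_degree \<alpha> \<le> d" "\<forall>\<alpha>. g \<alpha> \<noteq> 0 \<longrightarrow> total_degree \<alpha> \<le> e"
  then show "\<exists>d. \<forall>\<alpha>. f \<alpha> - g \<alpha> \<noteq> 0 \<longrightarrow> total_degree \<alpha> \<le> d"
    by (intro exI[of _ "max d e"]) (metis diff_zero max.coboundedI1 max.coboundedI2)
qed auto

lift_definition times_symfun :: "'a symfun \<Rightarrow> 'a symfun \<Rightarrow> 'a symfun" is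
  "\<lambda>f g \<alpha>. \<Sum>(\<beta>, \<gamma>) \<in> {(\<beta>, \<gamma>). \<beta> + \<gamma> = \<alpha>}. f \<beta> * g \<gamma>"
proof (elim conjE exE, intro conjI)
  fix f g :: "exponent \<Rightarrow> 'a" and d e
  assume f: "\<forall>\<alpha>. f \<alpha> \<noteq> 0 \<longrightarrow> total_degree \<alpha> \<le> d" and g: "\<forall>\<alpha>. g \<alpha> \<noteq> 0 \<longrightarrow> total_degree \<alpha> \<le> e"
  show "\<exists>d. \<forall>\<alpha>. (\<Sum>(\<beta>, \<gamma>) \<in> {(\<beta>, \<gamma>). \<beta> + \<gamma> = \<alpha>}. f \<beta> * g \<gamma>) \<noteq> 0 \<longrightarrow> total_degree \<alpha> \<le> d"
  proof (intro exI[of _ "d + e"] allI impI)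
    fix \<alpha> assume "(\<Sum>(\<beta>, \<gamma>) \<in> {(\<beta>, \<gamma>). \<beta> + \<gamma> = \<alpha>}. f \<beta> * g \<gamma>) \<noteq> 0"
    then obtain \<beta> \<gamma> where "\<beta> + \<gamma> = \<alpha>" "f \<beta> * g \<gamma> \<noteq> 0"
      by (auto elim!: sum.not_neutral_contains_not_neutral)
    moreover from this have "f \<beta> \<noteq> 0" "g \<gamma> \<noteq> 0" by auto
    ultimately show "total_degree \<alpha> \<le> d + e"
      using f g by (metis total_degree_add add_mono)
  qed
next
  fix f g :: "exponent \<Rightarrow> 'a"
  assume f: "\<forall>\<pi> \<alpha>. bij \<pi> \<longrightarrow> f (Poly_Mapping.map_key \<pi> \<alpha>) = f \<alpha>"
    and g: "\<forall>\<pi> \<alpha>. bij \<pi> \<longrightarrow> g (Poly_Mapping.map_key \<pi> \<alpha>) = g \<alpha>"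
  show "\<forall>\<pi> \<alpha>. bij \<pi> \<longrightarrow>
    (\<Sum>(\<beta>, \<gamma>) \<in> {(\<beta>, \<gamma>). \<beta> + \<gamma> = Poly_Mapping.map_key \<pi> \<alpha>}. f \<beta> * g \<gamma>) =
    (\<Sum>(\<beta>, \<gamma>) \<in> {(\<beta>, \<gamma>). \<beta> + \<gamma> = \<alpha>}. f \<beta> * g \<gamma>)"
  proof (intro allI impI)
    fix \<pi> :: "nat \<Rightarrow> nat" and \<alpha>
    assume \<pi>: "bij \<pi>"
    let ?p = "Poly_Mapping.map_key \<pi> :: exponent \<Rightarrow> exponent"
    let ?q = "Poly_Mapping.map_key (Hilbert_Choice.inv \<pi>) :: exponent \<Rightarrow> exponent"
    have inj: "inj \<pi>" "inj (Hilbert_Choice.inv \<pi>)"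
      using \<pi> bij_imp_bij_inv[OF \<pi>] by (auto dest: bij_is_inj)
    show "(\<Sum>(\<beta>, \<gamma>) \<in> {(\<beta>, \<gamma>). \<beta> + \<gamma> = ?p \<alpha>}. f \<beta> * g \<gamma>) =
        (\<Sum>(\<beta>, \<gamma>) \<in> {(\<beta>, \<gamma>). \<beta> + \<gamma> = \<alpha>}. f \<beta> * g \<gamma>)"
    proof (rule sum.reindex_bij_witness
        [where i = "\<lambda>(\<beta>, \<gamma>). (?p \<beta>, ?p \<gamma>)" and j = "\<lambda>(\<beta>, \<gamma>). (?q \<beta>, ?q \<gamma>)"], goal_cases)
      case (2 x)
      have "?q (fst x) + ?q (snd x) = ?q (fst x + snd x)"
        by (simp add: map_key_plus inj)
      with 2 show ?case by (auto simp: map_key_inv[OF \<pi>])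
    next
      case (4 x)
      have "?p (fst x) + ?p (snd x) = ?p (fst x + snd x)"
        by (simp add: map_key_plus inj)
      with 4 show ?case by auto
    next
      case (5 x)
      have "f (?q \<beta>) = f \<beta>" "g (?q \<beta>) = g \<beta>" for \<beta>
        using f g bij_imp_bij_inv[OF \<pi>] by blast+
      then show ?case by (simp add: case_prod_beta)
    qed (auto simp: map_key_inv[OF \<pi>])
  qed
qed

instance
proof
  fix a b c :: "'a symfun"
  show "a * b * c = a * (b * c)"
  proof (transfer, rule ext)
    fix f g h :: "exponent \<Rightarrow> 'a" and \<alpha> :: exponent
    have "(\<Sum>(\<beta>, \<gamma>) \<in> {(\<beta>, \<gamma>). \<beta> + \<gamma> = \<alpha>}. (\<Sum>(\<delta>, \<epsilon>) \<in> {(\<delta>, \<epsilon>). \<delta> + \<epsilon> = \<beta>}. f \<delta> * g \<epsilon>) * h \<gamma>)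
      = (\<Sum>p \<in> {(\<beta>, \<gamma>). \<beta> + \<gamma> = \<alpha>}. \<Sum>q \<in> {(\<delta>, \<epsilon>). \<delta> + \<epsilon> = fst p}.
          f (fst q) * g (snd q) * h (snd p))"
      by (simp add: case_prod_beta sum_distrib_right)
    also have "\<dots> = (\<Sum>(p, q) \<in> (SIGMA p:{(\<beta>, \<gamma>). \<beta> + \<gamma> = \<alpha>}. {(\<delta>, \<epsilon>). \<delta> + \<epsilon> = fst p}).
          f (fst q) * g (snd q) * h (snd p))"
      by (rule sum.Sigma) (auto simp: finite_exponent_splits)
    also have "\<dots> = (\<Sum>(p, q) \<in> (SIGMA p:{(\<beta>, \<gamma>). \<beta> + \<gamma> = \<alpha>}. {(\<delta>, \<epsilon>). \<delta> + \<epsilon> = snd p}).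
          f (fst p) * (g (fst q) * h (snd q)))"
      by (rule sum.reindex_bij_witness
            [where i = "\<lambda>(p, q). ((fst p + fst q, snd q), (fst p, fst q))"
               and j = "\<lambda>(p, q). ((fst q, snd q + snd p), (snd q, snd p))"])
        (auto simp: add.assoc mult.assoc)
    also have "\<dots> = (\<Sum>p \<in> {(\<beta>, \<gamma>). \<beta> + \<gamma> = \<alpha>}. \<Sum>q \<in> {(\<delta>, \<epsilon>). \<delta> + \<epsilon> = snd p}.
          f (fst p) * (g (fst q) * h (snd q)))"
      by (rule sum.Sigma[symmetric]) (auto simp: finite_exponent_splits)
    also have "\<dots> = (\<Sum>(\<beta>, \<gamma>) \<in> {(\<beta>, \<gamma>). \<beta> + \<gamma> = \<alpha>}. f \<beta> * (\<Sum>(\<delta>, \<epsilon>) \<in> {(\<delta>, \<epsilon>). \<delta> + \<epsilon> = \<gamma>}. g \<delta> * h \<epsilon>))"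
      by (simp add: case_prod_beta sum_distrib_left)
    finally show "(\<Sum>(\<beta>, \<gamma>) \<in> {(\<beta>, \<gamma>). \<beta> + \<gamma> = \<alpha>}. (\<Sum>(\<delta>, \<epsilon>) \<in> {(\<delta>, \<epsilon>). \<delta> + \<epsilon> = \<beta>}. f \<delta> * g \<epsilon>) * h \<gamma>)
      = (\<Sum>(\<beta>, \<gamma>) \<in> {(\<beta>, \<gamma>). \<beta> + \<gamma> = \<alpha>}. f \<beta> * (\<Sum>(\<delta>, \<epsilon>) \<in> {(\<delta>, \<epsilon>). \<delta> + \<epsilon> = \<gamma>}. g \<delta> * h \<epsilon>))" .
  qed
  show "a * b = b * a"
    by (transfer, rule ext,
        rule sum.reindex_bij_witness[where i = prod.swap and j = prod.swap])
      (auto simp: add.commute mult.commute)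
  show "1 * a = a"
  proof (transfer, rule ext)
    fix f :: "exponent \<Rightarrow> 'a" and \<alpha> :: exponent
    have "(\<Sum>(\<beta>, \<gamma>) \<in> {(\<beta>, \<gamma>). \<beta> + \<gamma> = \<alpha>}. (if \<beta> = 0 then 1 else 0) * f \<gamma>)
      = (\<Sum>(\<beta>, \<gamma>) \<in> {(0 :: exponent, \<alpha>)}. (if \<beta> = 0 then 1 else 0) * f \<gamma>)"
      by (rule sum.mono_neutral_right) (auto simp: finite_exponent_splits split: if_splits)
    then show "(\<Sum>(\<beta>, \<gamma>) \<in> {(\<beta>, \<gamma>). \<beta> + \<gamma> = \<alpha>}. (if \<beta> = 0 then 1 else 0) * f \<gamma>) = f \<alpha>"
      by simp
  qed
  show "(a + b) * c = a * c + b * c"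
    by (transfer, rule ext) (simp add: case_prod_beta distrib_right sum.distrib)
  show "a + b + c = a + (b + c)" "a + b = b + a" "0 + a = a" "- a + a = 0" "a - b = a + - b"
    by (transfer, simp add: algebra_simps)+
  show "(0 :: 'a symfun) \<noteq> 1"
    by transfer (auto dest: fun_cong[of _ _ 0])
qed

end

lift_definition sf_scale :: "'a :: comm_ring_1 \<Rightarrow> 'a symfun \<Rightarrow> 'a symfun" is "\<lambda>c f \<alpha>. c * f \<alpha>"
  by (metis mult_zero_right)

text \<open>The power sum $p_k = \sum_i x_i^k$, meaningful for $k \ge 1$ (the infinite sum does not define
  a symmetric function for $k = 0$, and cycle types have no part 0).\<close>

lift_definition power_sum :: "nat \<Rightarrow> 'a :: comm_ring_1 symfun" is
  "\<lambda>k \<alpha>. if \<exists>i. \<alpha> = Poly_Mapping.single i k then 1 else 0"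
proof (intro conjI, goal_cases)
  case (1 k)
  show ?case by (rule exI[of _ k]) (auto simp: total_degree_def)
next
  case (2 k)
  show ?case
  proof (intro allI impI)
    fix \<pi> :: "nat \<Rightarrow> nat" and \<alpha> :: exponent
    assume \<pi>: "bij \<pi>"
    have *: "\<exists>j. Poly_Mapping.map_key \<rho> (Poly_Mapping.single i k) = Poly_Mapping.single j k"
      if "bij \<rho>" for \<rho> :: "nat \<Rightarrow> nat" and i
      using map_key_single[of \<rho> "Hilbert_Choice.inv \<rho> i" k] that
      by (metis bij_is_inj bij_is_surj surj_f_inv_f)
    have "(\<exists>i. Poly_Mapping.map_key \<pi> \<alpha> = Poly_Mapping.single i k) \<longleftrightarrow>
        (\<exists>i. \<alpha> = Poly_Mapping.single i k)"
      using *[OF \<pi>] *[OF bij_imp_bij_inv[OF \<pi>]] map_key_inv(2)[OF \<pi>, of \<alpha>] by metis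
    then show "(if \<exists>i. Poly_Mapping.map_key \<pi> \<alpha> = Poly_Mapping.single i k then 1 else 0) =
        (if \<exists>i. \<alpha> = Poly_Mapping.single i k then 1 else 0)" by simp
  qed
qed

definition power_sum_partition :: "nat multiset \<Rightarrow> 'a :: comm_ring_1 symfun" where
  "power_sum_partition \<mu> = (\<Prod>k\<in>#\<mu>. power_sum k)"

text \<open>The cycles of \<open>g\<close>, fixed points included, are its orbits on \<open>{1..n}\<close>.\<close>

definition cycle_type :: "nat \<Rightarrow> (nat \<Rightarrow> nat) \<Rightarrow> nat multiset" where
  "cycle_type n g = image_mset card (mset_set (orbit g ` {1..n}))"

definition cycle_index :: "nat \<Rightarrow> (nat \<Rightarrow> nat) set \<Rightarrow> 'a :: field_char_0 symfun" where
  "cycle_index n G =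
     sf_scale (1 / of_nat (card G)) (\<Sum>g\<in>G. power_sum_partition (cycle_type n g))"


text \<open>A polynomial is a finitely supported coefficient function on exponent vectors. Exponent
  vectors are embedded in the real vector space \<^typ>\<open>nat \<Rightarrow>\<^sub>0 real\<close>; for a polynomial in the first
  \<open>m\<close> variables the convex hull lies in the coordinate subspace $\mathbb{R}^m$, and the lattice
  points of that space are its elements with integer coordinates.\<close>

definition real_exponent :: "exponent \<Rightarrow> (nat \<Rightarrow>\<^sub>0 real)" where
  "real_exponent \<alpha> = Poly_Mapping.map of_nat \<alpha>"

definition newton_polytope :: "(exponent \<Rightarrow>\<^sub>0 'a :: zero) \<Rightarrow> (nat \<Rightarrow>\<^sub>0 real) set" where
  "newton_polytope h = convex hull (real_exponent ` Poly_Mapping.keys h)"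

definition SNP_poly :: "(exponent \<Rightarrow>\<^sub>0 'a :: zero) \<Rightarrow> bool" where
  "SNP_poly h \<longleftrightarrow>
     (\<forall>v \<in> newton_polytope h. (\<forall>i. Poly_Mapping.lookup v i \<in> \<int>) \<longrightarrow>
        (\<exists>\<alpha>. v = real_exponent \<alpha> \<and> Poly_Mapping.lookup h \<alpha> \<noteq> 0))"

text \<open>$f(x_1,\ldots,x_m)$: setting the remaining variables to 0 kills exactly the monomials in
  which one of them occurs.\<close>

lift_definition sf_restrict :: "nat \<Rightarrow> 'a :: zero symfun \<Rightarrow> (exponent \<Rightarrow>\<^sub>0 'a)" is
  "\<lambda>m f \<alpha>. if Poly_Mapping.keys \<alpha> \<subseteq> {..<m} then f \<alpha> else 0"
proof (elim conjE exE)
  fix m d and f :: "exponent \<Rightarrow> 'a"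
  assume "\<forall>\<alpha>. f \<alpha> \<noteq> 0 \<longrightarrow> total_degree \<alpha> \<le> d"
  then have "{\<alpha>. (if Poly_Mapping.keys \<alpha> \<subseteq> {..<m} then f \<alpha> else 0) \<noteq> 0}
      \<subseteq> {\<alpha>. Poly_Mapping.keys \<alpha> \<subseteq> {..<m} \<and> total_degree \<alpha> \<le> d}"
    by auto
  then show "finite {\<alpha>. (if Poly_Mapping.keys \<alpha> \<subseteq> {..<m} then f \<alpha> else 0) \<noteq> 0}"
    by (rule finite_subset) (simp add: finite_bounded_exponents)
qed

definition SNP :: "'a :: zero symfun \<Rightarrow> bool" where
  "SNP f \<longleftrightarrow> (\<forall>m\<ge>1. SNP_poly (sf_restrict m f))"

end

theory Submission
  imports Defs
begin

text \<open>Every coefficient of \<open>|G| Z\<^sub>G\<close> is a natural number, and the identity of \<open>G\<close> contributes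
  $p_1^n$, whose coefficient at each exponent of degree \<open>n\<close> is a positive multinomial coefficient.
  As \<open>Z\<^sub>G\<close> is homogeneous of degree \<open>n\<close>, its exponents are all the exponents of degree \<open>n\<close>, i.e.\ all
  lattice points of a dilated standard simplex, which contains the Newton polytope.\<close>

lemma sf_coeff_sum: "sf_coeff (\<Sum>x\<in>A. f x) \<alpha> = (\<Sum>x\<in>A. sf_coeff (f x) \<alpha>)"
  by (induction A rule: infinite_finite_induct) (auto simp: zero_symfun.rep_eq plus_symfun.rep_eq)

lemma sum_in_Nats:
  fixes f :: "'b \<Rightarrow> 'a :: semiring_1"
  assumes "\<And>x. x \<in> A \<Longrightarrow> f x \<in> \<nat>"
  shows "sum f A \<in> \<nat>"
  using assms by (induction A rule: infinite_finite_induct) auto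

text \<open>No cancellation: natural summands add up as they do in \<open>nat\<close>, and
  characteristic 0 keeps the total nonzero. As \<open>'a\<close> carries no order, membership in
  \<open>\<nat>\<close> does the work of nonnegativity.\<close>

lemma sum_Nats_nonzero:
  fixes f :: "'b \<Rightarrow> 'a :: semiring_char_0"
  assumes "finite A" "\<And>x. x \<in> A \<Longrightarrow> f x \<in> \<nat>" "a \<in> A" "f a \<noteq> 0"
  shows "sum f A \<noteq> 0"
proof -
  obtain g where g: "f x = of_nat (g x)" if "x \<in> A" for x
    using bchoice[of A "\<lambda>x k. f x = of_nat k"] assms(2) by (auto simp: Nats_def)
  have sum: "sum f A = of_nat (sum g A)" unfolding of_nat_sum by (rule sum.cong) (simp_all add: g)
  have "g a \<noteq> 0" using g[of a] assms(3,4) by auto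
  then have "sum g A \<noteq> 0" using assms(1,3) by auto
  then show ?thesis unfolding sum of_nat_eq_0_iff .
qed

lemma sf_coeff_mult_Nats:
  assumes "\<And>\<alpha>. sf_coeff f \<alpha> \<in> \<nat>" "\<And>\<alpha>. sf_coeff g \<alpha> \<in> \<nat>"
  shows "sf_coeff (f * g) \<alpha> \<in> \<nat>"
  using assms by (auto simp: times_symfun.rep_eq intro!: Nats_mult sum_in_Nats)

lemma sf_coeff_power_sum_partition_Nats: "sf_coeff (power_sum_partition \<mu>) \<alpha> \<in> \<nat>"
proof (induction \<mu> arbitrary: \<alpha>)
  case (add k \<mu>)
  then show ?case
    unfolding power_sum_partition_def
    by (auto simp: power_sum.rep_eq intro!: sf_coeff_mult_Nats)
qed (simp add: power_sum_partition_def one_symfun.rep_eq)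

lemma sf_coeff_mult_nonzeroE:
  assumes "sf_coeff (f * g) \<alpha> \<noteq> 0"
  obtains \<beta> \<gamma> where "\<alpha> = \<beta> + \<gamma>" "sf_coeff f \<beta> \<noteq> 0" "sf_coeff g \<gamma> \<noteq> 0"
proof -
  from assms obtain \<beta> \<gamma> where "\<beta> + \<gamma> = \<alpha>" "sf_coeff f \<beta> * sf_coeff g \<gamma> \<noteq> 0"
    unfolding times_symfun.rep_eq by (auto elim!: sum.not_neutral_contains_not_neutral)
  then show ?thesis by (metis that mult_zero_left mult_zero_right)
qed

lemma total_degree_single [simp]: "total_degree (Poly_Mapping.single i k) = k"
  by (simp add: total_degree_def)

text \<open>Homogeneity: an exponent of a product is a sum of exponents of its factors, and those of
  \<open>power_sum k\<close> have degree \<open>k\<close>. This includes \<open>k = 0\<close>, where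
  \<open>power_sum 0\<close> is the constant 1.\<close>

lemma total_degree_power_sum_partition:
  assumes "sf_coeff (power_sum_partition \<mu>) \<alpha> \<noteq> 0"
  shows "total_degree \<alpha> = \<Sum>\<^sub># \<mu>"
  using assms
proof (induction \<mu> arbitrary: \<alpha>)
  case empty
  then show ?case
    by (auto simp: power_sum_partition_def one_symfun.rep_eq total_degree_def split: if_splits)
next
  case (add k \<mu>)
  from add.prems obtain \<beta> \<gamma> where \<alpha>: "\<alpha> = \<beta> + \<gamma>" and \<beta>: "sf_coeff (power_sum k :: 'a symfun) \<beta> \<noteq> 0"
    and \<gamma>: "sf_coeff (power_sum_partition \<mu> :: 'a symfun) \<gamma> \<noteq> 0"
    by (auto simp: power_sum_partition_def elim: sf_coeff_mult_nonzeroE)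
  have "total_degree \<beta> = k"
    using \<beta> by (auto simp: power_sum.rep_eq split: if_splits)
  with add.IH[OF \<gamma>] \<alpha> show ?case by (simp add: total_degree_add)
qed

text \<open>Any monomial of degree d can be built by choosing one variable from each of the d
  factors $p_1$. The induction splits off one such factor at a time.\<close>

lemma sf_coeff_power_sum_partition_ones:
  "sf_coeff (power_sum_partition (replicate_mset (total_degree \<alpha>) 1) :: 'a :: field_char_0 symfun) \<alpha> \<noteq> 0"
proof (induction "total_degree \<alpha>" arbitrary: \<alpha>)
  case 0
  have "\<alpha> = 0"
  proof (rule poly_mapping_eqI)
    show "Poly_Mapping.lookup \<alpha> i = Poly_Mapping.lookup 0 i" for i
      using lookup_le_total_degree[of \<alpha> i] 0 by simp
  qed
  with 0 show ?case by (simp add: power_sum_partition_def one_symfun.rep_eq)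
next
  case (Suc d)
  let ?p = "power_sum_partition (replicate_mset d 1) :: 'a symfun"
  from Suc.hyps(2) obtain i where i: "Poly_Mapping.lookup \<alpha> i \<noteq> 0"
    unfolding total_degree_def by (metis nat.simps(3) sum.neutral)
  \<comment> \<open>The truncated subtraction is exact because \<open>i\<close> occurs in
    \<open>\<alpha>\<close>.\<close>
  define \<beta> where "\<beta> = \<alpha> - Poly_Mapping.single i 1"
  have \<alpha>: "Poly_Mapping.single i 1 + \<beta> = \<alpha>"
    using i by (intro poly_mapping_eqI) (auto simp: \<beta>_def lookup_add lookup_minus lookup_single when_def)
  have d: "d = total_degree \<beta>"
    using Suc.hyps(2) total_degree_add[of "Poly_Mapping.single i 1" \<beta>, unfolded \<alpha>] by simp
  have "sf_coeff (power_sum 1 * ?p) \<alpha> \<noteq> 0"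
    unfolding times_symfun.rep_eq
  \<comment> \<open>All terms of the convolution are natural, so the single splitting of
    \<open>\<alpha>\<close> into \<open>Poly_Mapping.single i 1\<close> and \<open>\<beta>\<close>
    suffices.\<close>
  proof (rule sum_Nats_nonzero[OF finite_exponent_splits])
    show "(Poly_Mapping.single i 1, \<beta>) \<in> {(\<beta>, \<gamma>). \<beta> + \<gamma> = \<alpha>}" using \<alpha> by simp
    show "(case (Poly_Mapping.single i 1, \<beta>) of
        (\<beta>, \<gamma>) \<Rightarrow> sf_coeff (power_sum 1 :: 'a symfun) \<beta> * sf_coeff ?p \<gamma>) \<noteq> 0"
      using Suc.hyps(1)[OF d] d by (auto simp: power_sum.rep_eq)
  qed (auto simp: power_sum.rep_eq sf_coeff_power_sum_partition_Nats)
  then show ?case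
    by (simp add: Suc.hyps(2)[symmetric] power_sum_partition_def)
qed

text \<open>\<open>orbit g x\<close> collects the iterates from \<open>g x\<close> on. A permutation
  of finite support returns to \<open>x\<close>, so \<open>x\<close> lies in its own orbit, orbit
  membership is symmetric, and orbits are equivalence classes.\<close>

lemma orbit_permutes_disjoint:
  assumes "permutation g" "z \<in> orbit g x" "z \<in> orbit g y"
  shows "orbit g x = orbit g y"
  using assms by (meson orbit_swap orbit_trans permutation_self_in_orbit subsetI subset_antisym)

text \<open>The orbits partition \<open>{1..n}\<close>, and \<open>mset_set\<close> counts each of
  them once. This fixes the degree of the summand of every \<open>g\<close>.\<close>

lemma sum_cycle_type:
  assumes g: "g permutes {1..n}"
  shows "\<Sum>\<^sub># (cycle_type n g) = n"
proof -
  have perm: "permutation g" using g by (auto simp: permutation_permutes)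
  have sub: "orbit g x \<subseteq> {1..n}" if "x \<in> {1..n}" for x
    using permutes_orbit_subset[OF g that] .
  have "\<Sum>\<^sub># (cycle_type n g) = sum card (orbit g ` {1..n})"
    by (simp add: cycle_type_def sum_unfold_sum_mset)
  also have "\<dots> = card (\<Union> (orbit g ` {1..n}))"
  proof (rule card_Union_disjoint[symmetric])
    show "pairwise disjnt (orbit g ` {1..n})"
      using orbit_permutes_disjoint[OF perm] by (fastforce simp: pairwise_def disjnt_iff)
  qed (use sub finite_subset in blast)
  also have "\<Union> (orbit g ` {1..n}) = {1..n}"
    using sub permutation_self_in_orbit[OF perm] by blast
  finally show ?thesis by simp
qed

lemma cycle_type_id: "cycle_type n id = replicate_mset n 1"
proof -
  have "orbit id = (\<lambda>x :: nat. {x})"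
    by (rule ext) (simp add: orbit_eq_singleton_iff)
  \<comment> \<open>The map from \<open>x\<close> to \<open>{x}\<close> is injective, so the n
    points give n distinct orbits.\<close>
  then have "cycle_type n id = image_mset (\<lambda>_. 1) (mset_set {1..n})"
    by (simp add: cycle_type_def image_mset_mset_set[symmetric] multiset.map_comp o_def)
  then show ?thesis by (simp add: image_mset_const_eq)
qed

lemma sf_coeff_cycle_index_nonzero_iff:
  assumes "finite G" "id \<in> G" "\<And>g. g \<in> G \<Longrightarrow> g permutes {1..n}"
  shows "sf_coeff (cycle_index n G :: 'a :: field_char_0 symfun) \<alpha> \<noteq> 0 \<longleftrightarrow> total_degree \<alpha> = n"
proof -
  let ?p = "\<lambda>g. power_sum_partition (cycle_type n g) :: 'a symfun"
  \<comment> \<open>In characteristic 0 the scalar \<open>1 / of_nat (card G)\<close> is then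
    nonzero and leaves the support unchanged.\<close>
  have "card G \<noteq> 0" using assms by auto
  then have "sf_coeff (cycle_index n G :: 'a symfun) \<alpha> \<noteq> 0 \<longleftrightarrow> (\<Sum>g\<in>G. sf_coeff (?p g) \<alpha>) \<noteq> 0"
    by (simp add: cycle_index_def sf_scale.rep_eq sf_coeff_sum)
  also have "\<dots> \<longleftrightarrow> total_degree \<alpha> = n"
  proof
    assume "(\<Sum>g\<in>G. sf_coeff (?p g) \<alpha>) \<noteq> 0"
    then obtain g where "g \<in> G" "sf_coeff (?p g) \<alpha> \<noteq> 0"
      by (rule sum.not_neutral_contains_not_neutral)
    then show "total_degree \<alpha> = n"
      using total_degree_power_sum_partition sum_cycle_type assms(3) by metis
  next
    assume "total_degree \<alpha> = n"
    then have "sf_coeff (?p id) \<alpha> \<noteq> 0"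
      using sf_coeff_power_sum_partition_ones[of \<alpha>] by (simp add: cycle_type_id)
    then show "(\<Sum>g\<in>G. sf_coeff (?p g) \<alpha>) \<noteq> 0"
      by (rule sum_Nats_nonzero[OF assms(1) sf_coeff_power_sum_partition_Nats assms(2)])
  qed
  finally show ?thesis .
qed

text \<open>Scaling is defined through \<open>Abs_poly_mapping\<close>, so its coordinates can be
  read off once the scaled function is known to have finite support.\<close>

lemma lookup_scaleR [simp]:
  "Poly_Mapping.lookup (r *\<^sub>R v) i = r *\<^sub>R Poly_Mapping.lookup (v :: 'b \<Rightarrow>\<^sub>0 'c :: real_vector) i"
proof -
  have "finite {i. r *\<^sub>R Poly_Mapping.lookup v i \<noteq> 0}"
    by (rule finite_subset[OF _ finite_lookup[of v]]) auto
  then show ?thesis by (simp add: scaleR_poly_mapping_def Abs_poly_mapping_inverse)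
qed

lemma lookup_real_exponent [simp]:
  "Poly_Mapping.lookup (real_exponent \<alpha>) i = real (Poly_Mapping.lookup \<alpha> i)"
  by (simp add: real_exponent_def map.rep_eq when_def)

lemma SNP_poly_simplex:
  assumes h: "\<And>\<alpha>. Poly_Mapping.lookup h \<alpha> \<noteq> 0 \<longleftrightarrow>
      Poly_Mapping.keys \<alpha> \<subseteq> {..<m} \<and> total_degree \<alpha> = n"
  shows "SNP_poly h"
  unfolding SNP_poly_def
proof (intro ballI impI)
  fix v
  assume v: "v \<in> newton_polytope h" and int: "\<forall>i. Poly_Mapping.lookup v i \<in> \<int>"
  \<comment> \<open>The standard simplex dilated by n, inside the coordinate subspace $R^m$. It is
    convex and contains all exponents of \<open>h\<close>, hence also their hull.\<close>
  let ?S = "{w :: nat \<Rightarrow>\<^sub>0 real. (\<forall>i. Poly_Mapping.lookup w i \<ge> 0) \<and>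
    (\<forall>i\<ge>m. Poly_Mapping.lookup w i = 0) \<and> (\<Sum>i<m. Poly_Mapping.lookup w i) = real n}"
  have "convex ?S"
    by (rule convexI)
      (auto simp: lookup_add sum.distrib sum_distrib_left[symmetric] distrib_right[symmetric])
  moreover have "real_exponent ` Poly_Mapping.keys h \<subseteq> ?S"
  proof (rule image_subsetI)
    fix \<alpha> assume "\<alpha> \<in> Poly_Mapping.keys h"
    then have \<alpha>: "Poly_Mapping.keys \<alpha> \<subseteq> {..<m}" "total_degree \<alpha> = n"
      using h by (auto simp: in_keys_iff)
    then have "(\<Sum>i<m. Poly_Mapping.lookup \<alpha> i) = n"
      using total_degree_superset[of "{..<m}" \<alpha>] by simp
    then have "(\<Sum>i<m. real (Poly_Mapping.lookup \<alpha> i)) = real n"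
      by (metis of_nat_sum)
    with \<alpha> show "real_exponent \<alpha> \<in> ?S" by (auto simp: subset_iff in_keys_iff)
  qed
  ultimately have "newton_polytope h \<subseteq> ?S"
    unfolding newton_polytope_def by (rule hull_minimal[rotated])
  with v have S: "Poly_Mapping.lookup v i \<ge> 0" "i \<ge> m \<Longrightarrow> Poly_Mapping.lookup v i = 0"
    "(\<Sum>i<m. Poly_Mapping.lookup v i) = real n" for i by auto
  \<comment> \<open>The coordinates of \<open>v\<close> are nonnegative integers, so neither the
    floor nor \<open>nat\<close> changes them.\<close>
  define \<alpha> where "\<alpha> = Poly_Mapping.map (\<lambda>x. nat \<lfloor>x\<rfloor>) v"
  have lookup: "Poly_Mapping.lookup v i = real (Poly_Mapping.lookup \<alpha> i)" for i
    using int S(1)[of i] by (auto simp: \<alpha>_def map.rep_eq when_def elim: Ints_cases)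
  have keys: "Poly_Mapping.keys \<alpha> \<subseteq> {..<m}"
    using S(2) lookup by (auto simp: in_keys_iff intro: ccontr)
  moreover have "real (\<Sum>i<m. Poly_Mapping.lookup \<alpha> i) = real n"
    using S(3) lookup by simp
  ultimately have "total_degree \<alpha> = n"
    using total_degree_superset[OF _ keys] by (simp only: of_nat_eq_iff finite_lessThan)
  moreover have "v = real_exponent \<alpha>"
    by (rule poly_mapping_eqI) (simp add: lookup)
  ultimately show "\<exists>\<alpha>. v = real_exponent \<alpha> \<and> Poly_Mapping.lookup h \<alpha> \<noteq> 0"
    using h keys by blast
qed

theorem theorem2p30:
  fixes n :: nat and G :: "(nat \<Rightarrow> nat) set"
  assumes "subgroup G (sym_group n)"
  shows "SNP (cycle_index n G :: 'a :: field_char_0 symfun)"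
proof -
  have G: "g permutes {1..n}" if "g \<in> G" for g
    using subgroup.mem_carrier[OF assms that] by (simp add: sym_group_carrier)
  then have "finite G"
    by (intro finite_subset[OF _ finite_permutations[of "{1..n}"]]) auto
  moreover have "id \<in> G"
    using subgroup.one_closed[OF assms] by (simp add: sym_group_one)
  ultimately have coeff: "sf_coeff (cycle_index n G :: 'a symfun) \<alpha> \<noteq> 0 \<longleftrightarrow> total_degree \<alpha> = n" for \<alpha>
    using G by (rule sf_coeff_cycle_index_nonzero_iff)
  show ?thesis
    unfolding SNP_def
  proof (intro allI impI)
    fix m :: nat
    show "SNP_poly (sf_restrict m (cycle_index n G :: 'a symfun))"
      \<comment> \<open>Setting the later variables to 0 keeps exactly the exponents of degree
        \<open>n\<close> supported on the first \<open>m\<close> variables.\<close>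
      by (rule SNP_poly_simplex[of _ m n]) (simp add: sf_restrict.rep_eq coeff)
  qed
qed

end
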